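(* Let $M_u$ be any Pincherle realiser. Then there is a functional $\Delta$ that is Kleene-computable (S1–S9) in $M_u$ and $\exists^2$ such that, whenever $Y$ represents an open set $O\subseteq[0,1]$ in the sense of (R.2), $\Delta(Y)$ represents $O$ in the sense of (R.3).
   Context: Computability is Kleene's S1–S9. Reals are fast-converging Cauchy sequences of rationals; for reals $a<b$, $(a,b)$ denotes $(a,b)\cap[0,1]$. $\exists^2$ is the type-2 functional with $\exists^2(f)=0\leftrightarrow(\exists n)f(n)=0$ and $\exists^2(f)=1$ otherwise. Representations of an open set $O\subseteq[0,1]$: (R.2) a function $Y:[0,1]\to[0,1]$ such that (i) $O=\{x\in[0,1]:Y(x)>0\}$ and (ii) whenever $Y(x)>0$, $(x-Y(x),x+Y(x))\cap[0,1]\subseteq O$. (R.3) the continuous function $Y:[0,1]\to\mathbb{R}$ such that $Y(x)$ is the distance from $x$ to $[0,1]\setminus O$ if the latter is nonempty, and $Y$ is constantly $1$ if $O=[0,1]$. A Pincherle realiser is any type-3 functional $M_u$ such that for every $Y:[0,1]\to\mathbb{R}^+$, the number $M_u(Y)>0$ is a lower bound (on $[0,1]$) for every $Z:[0,1]\to\mathbb{R}$ that is locally bounded away from zero by $Y$, i.e. satisfies $(\forall x,y\in[0,1])(|x-y|<Y(x)\to Z(y)>Y(x))$. *)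

theory Defs
  imports "HOL-Analysis.Analysis" "HOL-Library.Nat_Bijection"
begin

section \<open>Kleene computability (S1--S9) over the pure types up to 3\<close>

type_synonym tp1 = "nat \<Rightarrow> nat"
type_synonym tp2 = "tp1 \<Rightarrow> nat"
type_synonym tp3 = "tp2 \<Rightarrow> nat"

text \<open>
  As in Kleene's presentation, the arguments of a computation are grouped by type, the relative
  order of arguments of different types being immaterial. So \<open>kleene e as fs Fs Gs v\<close> says that
  the computation of the index \<open>e\<close> on the numbers \<open>as\<close>, the functions \<open>fs\<close>, the type-2
  functionals \<open>Fs\<close> and the type-3 functionals \<open>Gs\<close> terminates with value \<open>v\<close>. The relation is the
  least one closed under the nine schemes. Only types up to 3 occur: when the arguments have type at
  most 3, the schemes introduce no argument of higher type.
\<close>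

text \<open>The list with its entry number \<open>k\<close> (counted from 0) moved to the front.\<close>

definition to_front :: "nat \<Rightarrow> 'a list \<Rightarrow> 'a list" where
  "to_front k xs = xs ! k # take k xs @ drop (Suc k) xs"

text \<open>
  In S8 the premise ranges over all objects of type 0 (type 1), so the functional is applied only to
  a total object. In S9 the number \<open>a\<close> is itself an argument, and it is applied as an index to initial
  segments of the remaining arguments, their lengths being part of the index.
\<close>

inductive kleene :: "nat \<Rightarrow> nat list \<Rightarrow> tp1 list \<Rightarrow> tp2 list \<Rightarrow> tp3 list \<Rightarrow> nat \<Rightarrow> bool" where
  S1: "kleene (list_encode [1]) (a # as) fs Fs Gs (Suc a)"
| S2: "kleene (list_encode [2, q]) as fs Fs Gs q"
| S3: "kleene (list_encode [3]) (a # as) fs Fs Gs a"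
| S4: "kleene d as fs Fs Gs u \<Longrightarrow> kleene c (u # as) fs Fs Gs v \<Longrightarrow>
       kleene (list_encode [4, c, d]) as fs Fs Gs v"
| S5_0: "kleene c as fs Fs Gs v \<Longrightarrow> kleene (list_encode [5, c, d]) (0 # as) fs Fs Gs v"
| S5_Suc: "kleene (list_encode [5, c, d]) (a # as) fs Fs Gs u \<Longrightarrow>
       kleene d (a # u # as) fs Fs Gs v \<Longrightarrow>
       kleene (list_encode [5, c, d]) (Suc a # as) fs Fs Gs v"
| S6_0: "k < length as \<Longrightarrow> kleene d (to_front k as) fs Fs Gs v \<Longrightarrow>
       kleene (list_encode [6, 0, k, d]) as fs Fs Gs v"
| S6_1: "k < length fs \<Longrightarrow> kleene d as (to_front k fs) Fs Gs v \<Longrightarrow>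
       kleene (list_encode [6, 1, k, d]) as fs Fs Gs v"
| S6_2: "k < length Fs \<Longrightarrow> kleene d as fs (to_front k Fs) Gs v \<Longrightarrow>
       kleene (list_encode [6, 2, k, d]) as fs Fs Gs v"
| S6_3: "k < length Gs \<Longrightarrow> kleene d as fs Fs (to_front k Gs) v \<Longrightarrow>
       kleene (list_encode [6, 3, k, d]) as fs Fs Gs v"
| S7: "kleene (list_encode [7]) (a # as) (f # fs) Fs Gs (f a)"
| S8_2: "(\<And>m. kleene d (m # as) fs (F # Fs) Gs (g m)) \<Longrightarrow>
       kleene (list_encode [8, 2, d]) as fs (F # Fs) Gs (F g)"
| S8_3: "(\<And>f. kleene d as (f # fs) Fs (G # Gs) (H f)) \<Longrightarrow>
       kleene (list_encode [8, 3, d]) as fs Fs (G # Gs) (G H)"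
| S9: "m0 \<le> length as \<Longrightarrow> m1 \<le> length fs \<Longrightarrow> m2 \<le> length Fs \<Longrightarrow> m3 \<le> length Gs \<Longrightarrow>
       kleene a (take m0 as) (take m1 fs) (take m2 Fs) (take m3 Gs) v \<Longrightarrow>
       kleene (list_encode [9, m0, m1, m2, m3]) (a # as) fs Fs Gs v"

text \<open>
  Standard codings of the types \<open>1 \<rightarrow> 1\<close> and \<open>(1 \<rightarrow> 1) \<rightarrow> 1\<close> in the pure types 2 and 3.
  The first is the bijection induced by pairing a number \<open>n\<close> and a function \<open>f\<close> to the function
  \<open>case_nat n f\<close>, i.e. the sequence n, f 0, f 1, ...; hence \<open>pure2 \<Phi> (case_nat n f) = \<Phi> f n\<close>.
  In the second, a type-2 functional \<open>F\<close> is read as a code of the pair consisting of the number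
  \<open>F (\<lambda>_. 0)\<close> and the operator \<open>\<lambda>f k. F (case_nat (Suc k) f)\<close>. Every such pair has a code, so no
  information about \<open>M\<close> is lost.
\<close>

definition pure2 :: "(tp1 \<Rightarrow> tp1) \<Rightarrow> tp2" where
  "pure2 \<Phi> h = \<Phi> (\<lambda>i. h (Suc i)) (h 0)"

definition pure3 :: "((tp1 \<Rightarrow> tp1) \<Rightarrow> tp1) \<Rightarrow> tp3" where
  "pure3 M F = M (\<lambda>f k. F (case_nat (Suc k) f)) (F (\<lambda>_. 0))"

text \<open>
  Kleene computability of a total functional of type \<open>(1 \<rightarrow> 1) \<rightarrow> (1 \<rightarrow> 1)\<close> in given functionals.
\<close>

definition kleene_computable_in ::
  "tp2 list \<Rightarrow> tp3 list \<Rightarrow> ((tp1 \<Rightarrow> tp1) \<Rightarrow> (tp1 \<Rightarrow> tp1)) \<Rightarrow> bool" where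
  "kleene_computable_in Fs Gs \<Delta> \<longleftrightarrow>
     (\<exists>e. \<forall>\<Phi> f n. kleene e [n] [f] (pure2 \<Phi> # Fs) Gs (\<Delta> \<Phi> f n))"

definition exists2 :: tp2 where
  "exists2 f = (if \<exists>n. f n = 0 then 0 else 1)"


section \<open>Real numbers and real functions as objects of finite type\<close>

text \<open>
  \<^const>\<open>nat_to_rat_surj\<close> is the explicit coding of rationals (as fractions of integers) by numbers.
\<close>

definition fast_cauchy :: "tp1 \<Rightarrow> bool" where
  "fast_cauchy f \<longleftrightarrow>
     (\<forall>n i. \<bar>nat_to_rat_surj (f n) - nat_to_rat_surj (f (n + i))\<bar> < 1 / 2 ^ n)"

definition real_name :: "tp1 \<Rightarrow> real \<Rightarrow> bool" where
  "real_name f x \<longleftrightarrow>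
     fast_cauchy f \<and> (\<lambda>n. of_rat (nat_to_rat_surj (f n))) \<longlonglongrightarrow> x"

text \<open>
  \<open>\<Phi>\<close> sends every name of every \<open>x \<in> [0,1]\<close> to a name of \<open>Y x\<close>; its values at other arguments are
  arbitrary.
\<close>

definition fun_name :: "(tp1 \<Rightarrow> tp1) \<Rightarrow> (real \<Rightarrow> real) \<Rightarrow> bool" where
  "fun_name \<Phi> Y \<longleftrightarrow> (\<forall>x\<in>{0..1}. \<forall>f. real_name f x \<longrightarrow> real_name (\<Phi> f) (Y x))"


section \<open>Representations of open subsets of the unit interval\<close>

definition R2 :: "(real \<Rightarrow> real) \<Rightarrow> real set \<Rightarrow> bool" where
  "R2 Y U \<longleftrightarrow>
     (\<forall>x\<in>{0..1}. Y x \<in> {0..1}) \<and>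
     U = {x \<in> {0..1}. Y x > 0} \<and>
     (\<forall>x\<in>{0..1}. Y x > 0 \<longrightarrow> {x - Y x<..<x + Y x} \<inter> {0..1} \<subseteq> U)"

definition R3 :: "(real \<Rightarrow> real) \<Rightarrow> real set \<Rightarrow> bool" where
  "R3 Y U \<longleftrightarrow>
     continuous_on {0..1} Y \<and>
     (\<forall>x\<in>{0..1}. Y x = (if {0..1} - U \<noteq> {} then infdist x ({0..1} - U) else 1))"

definition represents_R2 :: "(tp1 \<Rightarrow> tp1) \<Rightarrow> real set \<Rightarrow> bool" where
  "represents_R2 \<Phi> U \<longleftrightarrow> (\<exists>Y. fun_name \<Phi> Y \<and> R2 Y U)"

definition represents_R3 :: "(tp1 \<Rightarrow> tp1) \<Rightarrow> real set \<Rightarrow> bool" where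
  "represents_R3 \<Phi> U \<longleftrightarrow> (\<exists>Y. fun_name \<Phi> Y \<and> R3 Y U)"


section \<open>Pincherle realisers\<close>

definition bounded_away_by :: "(real \<Rightarrow> real) \<Rightarrow> (real \<Rightarrow> real) \<Rightarrow> bool" where
  "bounded_away_by Y Z \<longleftrightarrow> (\<forall>x\<in>{0..1}. \<forall>y\<in>{0..1}. \<bar>x - y\<bar> < Y x \<longrightarrow> Z y > Y x)"

text \<open>
  A realiser acts on names: on different names of the same function \<open>Y\<close> it may return different
  lower bounds.
\<close>

definition pincherle_realiser :: "((tp1 \<Rightarrow> tp1) \<Rightarrow> tp1) \<Rightarrow> bool" where
  "pincherle_realiser M \<longleftrightarrow>
     (\<forall>\<Phi> Y. fun_name \<Phi> Y \<and> (\<forall>x\<in>{0..1}. Y x > 0) \<longrightarrow>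
        (\<exists>m>0. real_name (M \<Phi>) m \<and>
           (\<forall>Z. bounded_away_by Y Z \<longrightarrow> (\<forall>x\<in>{0..1}. m \<le> Z x))))"

end

theory Submission
  imports Defs
begin

text \<open>
  Let \<open>Y\<close> represent \<open>U\<close> in the sense of (R.2), and let \<open>x \<in> [0,1]\<close> and \<open>r \<ge> 0\<close>. Let \<open>Y\<^sub>N y\<close> be
  \<open>1 / 2 ^ k\<close> for the least \<open>k\<close> with \<open>1 / 2 ^ k < Y y\<close> or \<open>r + 1 / 2 ^ k < \<bar>y - x\<bar>\<close>, and \<open>1 / 2 ^ N\<close> if there is no
  such \<open>k\<close>. If the closed ball of radius \<open>r\<close> around \<open>x\<close> is included in \<open>U\<close>, then \<open>Y\<^sub>N\<close> does not
  depend on \<open>N\<close>. If it contains a point \<open>z\<close> outside \<open>U\<close>, then \<open>z\<close> lies in the ball of radius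
  \<open>Y\<^sub>N y\<close> around \<open>y\<close> only if \<open>Y\<^sub>N y = 1 / 2 ^ N\<close>, so the bound given by the Pincherle realiser at
  \<open>Y\<^sub>N\<close> is at most \<open>2 / 2 ^ N\<close>. Hence the ball is included in \<open>U\<close> iff the realiser, applied to names of
  the \<open>Y\<^sub>N\<close> that differ only if the functions do, returns the same sequence for all \<open>N\<close>.
  The functional \<open>\<exists>\<^sup>2\<close> decides this, and the distance from \<open>x\<close> to the complement of \<open>U\<close> is
  approximated by testing the radii \<open>j / 2 ^ n\<close>. All searches are bounded.
\<close>

section \<open>Closure properties of Kleene computability\<close>

type_synonym env = "(tp1 \<Rightarrow> tp1) \<times> nat list \<times> tp1 list"

text \<open>The argument lists serve as stacks: a bound variable is pushed in front, so below a
  binder the outer variables are reached through the \<open>pop\<close> operations.\<close>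

definition orc :: "env \<Rightarrow> tp1 \<Rightarrow> tp1" where "orc e = fst e"
definition top_num :: "env \<Rightarrow> nat" where "top_num e = hd (fst (snd e))"
definition pop_num :: "env \<Rightarrow> env" where "pop_num e = (fst e, tl (fst (snd e)), snd (snd e))"
definition top_fun :: "env \<Rightarrow> tp1" where "top_fun e = hd (snd (snd e))"
definition pop_fun :: "env \<Rightarrow> env" where "pop_fun e = (fst e, fst (snd e), tl (snd (snd e)))"

lemmas env_defs = orc_def top_num_def pop_num_def top_fun_def pop_fun_def

lemma to_front_last: "to_front (length xs) (xs @ [x]) = x # xs"
  by (simp add: to_front_def)

declare list_encode.simps [simp del]

context
  fixes G :: tp3
begin

text \<open>
  An environment consists of an oracle, numbers and functions. In \<open>kc p q V\<close>, the functional \<open>V\<close> is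
  computed from \<open>p\<close> numbers and \<open>q\<close> functions by one index for all oracles; its values at other
  environments are irrelevant. The argument of a sequence (\<open>kf\<close>) is the first number; the truth value
  \<open>True\<close> is represented by 0 (\<open>kd\<close>), as in \<^const>\<open>exists2\<close>.
\<close>

definition kc :: "nat \<Rightarrow> nat \<Rightarrow> (env \<Rightarrow> nat) \<Rightarrow> bool" where
  "kc p q V \<longleftrightarrow> (\<exists>d. \<forall>\<Phi> as fs. length as = p \<longrightarrow> length fs = q \<longrightarrow>
     kleene d as fs [pure2 \<Phi>, exists2] [G] (V (\<Phi>, as, fs)))"

definition kf :: "nat \<Rightarrow> nat \<Rightarrow> (env \<Rightarrow> tp1) \<Rightarrow> bool" where
  "kf p q x \<longleftrightarrow> kc (Suc p) q (\<lambda>e. x (pop_num e) (top_num e))"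

definition kd :: "nat \<Rightarrow> nat \<Rightarrow> (env \<Rightarrow> bool) \<Rightarrow> bool" where
  "kd p q P \<longleftrightarrow> kc p q (\<lambda>e. if P e then 0 else 1)"

lemma kcI:
  "(\<And>\<Phi> as fs. length as = p \<Longrightarrow> length fs = q \<Longrightarrow>
     kleene d as fs [pure2 \<Phi>, exists2] [G] (V (\<Phi>, as, fs))) \<Longrightarrow> kc p q V"
  unfolding kc_def by blast

lemma kcE:
  assumes "kc p q V"
  obtains d where "\<And>\<Phi> as fs. length as = p \<Longrightarrow> length fs = q \<Longrightarrow>
     kleene d as fs [pure2 \<Phi>, exists2] [G] (V (\<Phi>, as, fs))"
  using assms unfolding kc_def by blast

text \<open>Separates the bound number from the rest of the environment, which is the form that the
  premises of S4, S5 and S8 have.\<close>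

lemma kcE_num:
  assumes "kc (Suc p) q (\<lambda>e. v (top_num e) (pop_num e))"
  obtains d where "\<And>\<Phi> m as fs. length as = p \<Longrightarrow> length fs = q \<Longrightarrow>
     kleene d (m # as) fs [pure2 \<Phi>, exists2] [G] (v m (\<Phi>, as, fs))"
proof -
  obtain d where d: "\<And>\<Phi> as fs. length as = Suc p \<Longrightarrow> length fs = q \<Longrightarrow>
     kleene d as fs [pure2 \<Phi>, exists2] [G] (v (top_num (\<Phi>, as, fs)) (pop_num (\<Phi>, as, fs)))"
    using assms by (elim kcE) blast
  show ?thesis
    by (rule that) (use d[of "_ # _"] in \<open>simp add: env_defs\<close>)
qed

lemma kcE_fun:
  assumes "kc p (Suc q) (\<lambda>e. v (top_fun e) (pop_fun e))"
  obtains d where "\<And>\<Phi> h as fs. length as = p \<Longrightarrow> length fs = q \<Longrightarrow>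
     kleene d as (h # fs) [pure2 \<Phi>, exists2] [G] (v h (\<Phi>, as, fs))"
proof -
  obtain d where d: "\<And>\<Phi> as fs. length as = p \<Longrightarrow> length fs = Suc q \<Longrightarrow>
     kleene d as fs [pure2 \<Phi>, exists2] [G] (v (top_fun (\<Phi>, as, fs)) (pop_fun (\<Phi>, as, fs)))"
    using assms by (elim kcE) blast
  show ?thesis
    by (rule that) (use d[of _ "_ # _"] in \<open>simp add: env_defs\<close>)
qed

lemma kc_cong:
  assumes "kc p q V"
    and "\<And>\<Phi> as fs. length as = p \<Longrightarrow> length fs = q \<Longrightarrow> V (\<Phi>, as, fs) = W (\<Phi>, as, fs)"
  shows "kc p q W"
  using assms unfolding kc_def by metis

lemma kc_const: "kc p q (\<lambda>e. n)"
  by (rule kcI, rule S2)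

lemma kc_top: "kc (Suc p) q top_num"
proof (rule kcI)
  fix \<Phi> :: "tp1 \<Rightarrow> tp1" and as :: "nat list" and fs :: "tp1 list"
  assume "length as = Suc p"
  then show "kleene (list_encode [3]) as fs [pure2 \<Phi>, exists2] [G] (top_num (\<Phi>, as, fs))"
    by (cases as) (auto simp: env_defs intro: S3)
qed

lemma kc_let:
  assumes "kc p q u" and "kc (Suc p) q (\<lambda>e. v (top_num e) (pop_num e))"
  shows "kc p q (\<lambda>e. v (u e) e)"
proof -
  obtain c where
    c: "\<And>\<Phi> as fs. length as = p \<Longrightarrow> length fs = q \<Longrightarrow>
      kleene c as fs [pure2 \<Phi>, exists2] [G] (u (\<Phi>, as, fs))"
    using assms(1) by (rule kcE) blast
  obtain d where
    d: "\<And>\<Phi> m as fs. length as = p \<Longrightarrow> length fs = q \<Longrightarrow>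
      kleene d (m # as) fs [pure2 \<Phi>, exists2] [G] (v m (\<Phi>, as, fs))"
    using assms(2) by (rule kcE_num) blast
  show ?thesis
  proof (rule kcI)
    fix \<Phi> :: "tp1 \<Rightarrow> tp1" and as :: "nat list" and fs :: "tp1 list"
    assume l: "length as = p" "length fs = q"
    from c[OF l] d[OF l] show "kleene (list_encode [4, d, c]) as fs [pure2 \<Phi>, exists2] [G] (v (u (\<Phi>, as, fs)) (\<Phi>, as, fs))"
      by (rule S4)
  qed
qed

lemma kc_Suc:
  assumes "kc p q u" shows "kc p q (\<lambda>e. Suc (u e))"
proof (rule kc_let[OF assms])
  show "kc (Suc p) q (\<lambda>e. Suc (top_num e))"
  proof (rule kcI)
    fix \<Phi> :: "tp1 \<Rightarrow> tp1" and as :: "nat list" and fs :: "tp1 list"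
    assume "length as = Suc p"
    then show "kleene (list_encode [1]) as fs [pure2 \<Phi>, exists2] [G] (Suc (top_num (\<Phi>, as, fs)))"
      by (cases as) (auto simp: env_defs simp del: One_nat_def intro: S1)
  qed
qed

text \<open>The first number is moved to the end by rotations (S6), where S9 drops it.\<close>

lemma kc_weak:
  assumes "kc p q V" shows "kc (Suc p) q (\<lambda>e. V (pop_num e))"
proof -
  obtain d where d: "\<And>\<Phi> as fs. length as = p \<Longrightarrow> length fs = q \<Longrightarrow>
      kleene d as fs [pure2 \<Phi>, exists2] [G] (V (\<Phi>, as, fs))"
    using assms by (elim kcE) blast
  define c where "c = list_encode [4, list_encode [9, p, q, 2, 1], list_encode [2, d]]"
  have "\<exists>r. \<forall>\<Phi> as bs v fs. length as + length bs = p \<longrightarrow> length bs = k \<longrightarrow> length fs = q \<longrightarrow>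
      kleene r (as @ v # bs) fs [pure2 \<Phi>, exists2] [G] (V (\<Phi>, bs @ as, fs))" if "k \<le> p" for k
    using that
  proof (induction k)
    case 0
    have "kleene c (as @ [v]) fs [pure2 \<Phi>, exists2] [G] (V (\<Phi>, as, fs))"
      if "length as = p" "length fs = q" for \<Phi> as v fs
      unfolding c_def
    proof (rule S4[OF S2], rule S9)
      show "kleene d (take p (as @ [v])) (take q fs) (take 2 [pure2 \<Phi>, exists2]) (take 1 [G])
         (V (\<Phi>, as, fs))"
        using d[of as fs] that by simp
    qed (use that in auto)
    then show ?case by (intro exI[of _ c]) auto
  next
    case (Suc k)
    then obtain r where r: "\<And>\<Phi> as bs v fs. length as + length bs = p \<Longrightarrow> length bs = k \<Longrightarrow> length fs = q \<Longrightarrow>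
      kleene r (as @ v # bs) fs [pure2 \<Phi>, exists2] [G] (V (\<Phi>, bs @ as, fs))"
      by (metis Suc_leD)
    have "kleene (list_encode [6, 0, p, r]) (as @ v # bs) fs [pure2 \<Phi>, exists2] [G] (V (\<Phi>, bs @ as, fs))"
      if l: "length as + length bs = p" "length bs = Suc k" "length fs = q" for \<Phi> as bs v fs
    proof (rule S6_0)
      obtain cs b where bs: "bs = cs @ [b]" using l(2) by (cases bs rule: rev_cases) auto
      have "to_front p (as @ v # bs) = (b # as) @ v # cs"
        using to_front_last[of "as @ v # cs" b] l(1) by (simp add: bs)
      then show "kleene r (to_front p (as @ v # bs)) fs [pure2 \<Phi>, exists2] [G] (V (\<Phi>, bs @ as, fs))"
        using r[of "b # as" cs fs v \<Phi>] l by (simp add: bs)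
    qed (use l in simp)
    then show ?case by blast
  qed
  from this[of p] obtain r where r: "\<And>\<Phi> as bs v fs. length as + length bs = p \<Longrightarrow> length bs = p \<Longrightarrow> length fs = q \<Longrightarrow>
      kleene r (as @ v # bs) fs [pure2 \<Phi>, exists2] [G] (V (\<Phi>, bs @ as, fs))" by blast
  show ?thesis
  proof (rule kcI)
    fix \<Phi> :: "tp1 \<Rightarrow> tp1" and as :: "nat list" and fs :: "tp1 list"
    assume "length as = Suc p" "length fs = q"
    then show "kleene r as fs [pure2 \<Phi>, exists2] [G] (V (pop_num (\<Phi>, as, fs)))"
      using r[of "[]" "tl as" fs "hd as" \<Phi>] by (cases as) (auto simp: env_defs)
  qed
qed

lemma kc_rec:
  assumes "kc p q a" "kc (Suc (Suc p)) q (\<lambda>e. s (top_num e) (top_num (pop_num e)) (pop_num (pop_num e)))"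
    "kc p q n"
  shows "kc p q (\<lambda>e. rec_nat (a e) (\<lambda>m u. s m u e) (n e))"
proof -
  obtain c where
    c: "\<And>\<Phi> as fs. length as = p \<Longrightarrow> length fs = q \<Longrightarrow>
      kleene c as fs [pure2 \<Phi>, exists2] [G] (a (\<Phi>, as, fs))"
    using assms(1) by (rule kcE) blast
  obtain d' where
    d': "\<And>\<Phi> m as fs. length as = Suc p \<Longrightarrow> length fs = q \<Longrightarrow>
      kleene d' (m # as) fs [pure2 \<Phi>, exists2] [G] (s m (top_num (\<Phi>, as, fs)) (pop_num (\<Phi>, as, fs)))"
    using assms(2) by (rule kcE_num) blast
  have d: "length as = p \<Longrightarrow> length fs = q \<Longrightarrow>
      kleene d' (m # u # as) fs [pure2 \<Phi>, exists2] [G] (s m u (\<Phi>, as, fs))"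
    for \<Phi> m u as fs using d'[of "u # as" fs m \<Phi>] by (simp add: env_defs)
  show ?thesis
  \<comment> \<open>S5 recurses on the first number, so the value of \<open>n\<close> is first put
    there.\<close>
  proof (rule kc_let[OF assms(3)], rule kcI)
    fix \<Phi> :: "tp1 \<Rightarrow> tp1" and bs :: "nat list" and fs :: "tp1 list"
    assume l: "length bs = Suc p" "length fs = q"
    then obtain k as where bs: "bs = k # as" "length as = p" by (cases bs) auto
    have "kleene (list_encode [5, c, d']) (k # as) fs [pure2 \<Phi>, exists2] [G]
        (rec_nat (a (\<Phi>, as, fs)) (\<lambda>m u. s m u (\<Phi>, as, fs)) k)"
    proof (induction k)
      case 0
      show ?case using S5_0[OF c[OF bs(2) l(2)]] by simp
    next
      case (Suc k)
      show ?case using S5_Suc[OF Suc d[OF bs(2) l(2)]] by simp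
    qed
    then show "kleene (list_encode [5, c, d']) bs fs [pure2 \<Phi>, exists2] [G]
       (rec_nat (a (pop_num (\<Phi>, bs, fs))) (\<lambda>m u. s m u (pop_num (\<Phi>, bs, fs))) (top_num (\<Phi>, bs, fs)))"
      by (simp add: bs env_defs)
  qed
qed

lemma kf_top: "kf p (Suc q) top_fun"
  unfolding kf_def
proof (rule kcI)
  fix \<Phi> :: "tp1 \<Rightarrow> tp1" and as :: "nat list" and fs :: "tp1 list"
  assume "length as = Suc p" "length fs = Suc q"
  then show "kleene (list_encode [7]) as fs [pure2 \<Phi>, exists2] [G]
      (top_fun (pop_num (\<Phi>, as, fs)) (top_num (\<Phi>, as, fs)))"
    by (cases as; cases fs) (auto simp: env_defs intro: S7)
qed

lemma kf_top_pop: "kf p (Suc (Suc q)) (\<lambda>e. top_fun (pop_fun e))"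
  unfolding kf_def
proof (rule kcI)
  fix \<Phi> :: "tp1 \<Rightarrow> tp1" and bs :: "nat list" and fs :: "tp1 list"
  assume "length bs = Suc p" "length fs = Suc (Suc q)"
  then obtain a as f g gs where *: "bs = a # as" "fs = f # g # gs"
    by (auto simp: length_Suc_conv)
  show "kleene (list_encode [6, 1, 1, list_encode [7]]) bs fs [pure2 \<Phi>, exists2] [G]
      (top_fun (pop_fun (pop_num (\<Phi>, bs, fs))) (top_num (\<Phi>, bs, fs)))"
    by (rule S6_1) (auto simp: * env_defs to_front_def intro: S7)
qed

lemma kf_app:
  assumes "kf p q x" "kc p q t" shows "kc p q (\<lambda>e. x e (t e))"
  using kc_let[OF assms(2) assms(1)[unfolded kf_def]] .

lemma kd_ex:
  assumes "kd (Suc p) q (\<lambda>e. P (top_num e) (pop_num e))"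
  shows "kd p q (\<lambda>e. \<exists>m. P m e)"
proof -
  obtain d where d: "\<And>\<Phi> m as fs. length as = p \<Longrightarrow> length fs = q \<Longrightarrow>
      kleene d (m # as) fs [pure2 \<Phi>, exists2] [G] (if P m (\<Phi>, as, fs) then 0 else 1)"
    using assms unfolding kd_def by (rule kcE_num) blast
  \<comment> \<open>The outer S6 brings \<open>exists2\<close> to the front for S8; the inner one
    restores the order that \<open>d\<close> expects.\<close>
  have "kleene (list_encode [6, 2, 1, list_encode [8, 2, list_encode [6, 2, 1, d]]]) as fs
      [pure2 \<Phi>, exists2] [G] (if \<exists>m. P m (\<Phi>, as, fs) then 0 else 1)"
    if l: "length as = p" "length fs = q" for \<Phi> as fs
  proof (rule S6_2)
    have "kleene (list_encode [6, 2, 1, d]) (m # as) fs [exists2, pure2 \<Phi>] [G]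
        (if P m (\<Phi>, as, fs) then 0 else 1)" for m
      by (rule S6_2) (use d[OF l] in \<open>auto simp: to_front_def\<close>)
    then have "kleene (list_encode [8, 2, list_encode [6, 2, 1, d]]) as fs [exists2, pure2 \<Phi>] [G]
        (exists2 (\<lambda>m. if P m (\<Phi>, as, fs) then 0 else 1))"
      by (rule S8_2)
    then show "kleene (list_encode [8, 2, list_encode [6, 2, 1, d]]) as fs
        (to_front 1 [pure2 \<Phi>, exists2]) [G] (if \<exists>m. P m (\<Phi>, as, fs) then 0 else 1)"
      by (simp add: to_front_def exists2_def if_distrib cong: if_cong)
  qed simp
  then show ?thesis unfolding kd_def by (rule kcI)
qed

lemma kc_orc2:
  assumes "kf p q x"
  shows "kc p q (\<lambda>e. pure2 (orc e) (x e))"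
proof -
  obtain d where d: "\<And>\<Phi> m as fs. length as = p \<Longrightarrow> length fs = q \<Longrightarrow>
      kleene d (m # as) fs [pure2 \<Phi>, exists2] [G] (x (\<Phi>, as, fs) m)"
    using assms unfolding kf_def by (rule kcE_num) blast
  show ?thesis
    by (rule kcI[where d = "list_encode [8, 2, d]"]) (auto simp: env_defs intro: S8_2 d)
qed

lemma kc_functional:
  assumes "kc p (Suc q) (\<lambda>e. H (top_fun e) (pop_fun e))"
  shows "kc p q (\<lambda>e. G (\<lambda>h. H h e))"
proof -
  obtain d where d: "\<And>\<Phi> h as fs. length as = p \<Longrightarrow> length fs = q \<Longrightarrow>
      kleene d as (h # fs) [pure2 \<Phi>, exists2] [G] (H h (\<Phi>, as, fs))"
    using assms by (rule kcE_fun) blast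
  show ?thesis
    by (rule kcI[where d = "list_encode [8, 3, d]"]) (auto intro: S8_3 d)
qed

text \<open>The argument of the sequence lies in front of the number to be dropped, so S6 swaps the
  two before the index from \<open>kc_weak\<close> is used.\<close>

lemma kf_weak:
  assumes "kf p q x" shows "kf (Suc p) q (\<lambda>e. x (pop_num e))"
proof -
  obtain d where d: "\<And>\<Phi> as fs. length as = Suc (Suc p) \<Longrightarrow> length fs = q \<Longrightarrow>
      kleene d as fs [pure2 \<Phi>, exists2] [G] (x (pop_num (pop_num (\<Phi>, as, fs))) (top_num (pop_num (\<Phi>, as, fs))))"
    using kc_weak[OF assms[unfolded kf_def]] by (elim kcE) blast
  show ?thesis
    unfolding kf_def
  proof (rule kcI)
    fix \<Phi> :: "tp1 \<Rightarrow> tp1" and bs :: "nat list" and fs :: "tp1 list"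
    assume l: "length bs = Suc (Suc p)" "length fs = q"
    then obtain a b as where bs: "bs = a # b # as" "length as = p"
      by (auto simp: length_Suc_conv)
    show "kleene (list_encode [6, 0, 1, d]) bs fs [pure2 \<Phi>, exists2] [G]
       (x (pop_num (pop_num (\<Phi>, bs, fs))) (top_num (\<Phi>, bs, fs)))"
      by (rule S6_0) (use d[of "b # a # as" fs \<Phi>] l bs in \<open>auto simp: env_defs to_front_def\<close>)
  qed
qed

end

section \<open>Computable arithmetic\<close>

text \<open>Bounded search is primitive recursive: the candidate \<open>u\<close> grows by one in
  each step until it satisfies \<open>P\<close>, and then stays.\<close>

lemma bounded_least_rec:
  "(LEAST j. b \<le> j \<or> P j) = rec_nat 0 (\<lambda>m u. if P u then u else Suc u) b"
proof (induction b)
  case 0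
  then show ?case by simp
next
  case (Suc b)
  define l where "l = (LEAST j. b \<le> j \<or> P j)"
  have l: "b \<le> l \<or> P l" unfolding l_def by (rule LeastI[of _ b]) simp
  have le: "l \<le> b" unfolding l_def by (rule Least_le) simp
  have lt: "\<not> P j \<and> j < b" if "j < l" for j
    using not_less_Least[OF that[unfolded l_def]] by simp
  have "(LEAST j. Suc b \<le> j \<or> P j) = (if P l then l else Suc l)"
  proof (rule Least_equality)
    show "Suc b \<le> (if P l then l else Suc l) \<or> P (if P l then l else Suc l)"
      using l by auto
    show "(if P l then l else Suc l) \<le> y" if "Suc b \<le> y \<or> P y" for y
      using that le lt[of y] by (cases y l rule: linorder_cases) auto
  qed
  then show ?case using Suc by (simp add: l_def)
qed

lemma half_Least: "n div 2 = (LEAST k. n \<le> k \<or> n \<le> Suc (k + k))" for n :: nat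
  by (rule Least_equality[symmetric]) auto

text \<open>Neither component exceeds the code, so decoding is a bounded search that uses encoding
  as its test.\<close>

lemma prod_decode_Least:
  "fst (prod_decode c) = (LEAST a. c \<le> a \<or> (\<exists>b. prod_encode (a, b) = c))"
  "snd (prod_decode c) = (LEAST b. c \<le> b \<or> (\<exists>a. prod_encode (a, b) = c))"
proof -
  obtain a b where c: "c = prod_encode (a, b)" by (metis prod_decode_inverse surj_pair)
  show "fst (prod_decode c) = (LEAST a. c \<le> a \<or> (\<exists>b. prod_encode (a, b) = c))"
    by (rule Least_equality[symmetric]) (auto simp: c intro: le_trans[OF le_prod_encode_1])
  show "snd (prod_decode c) = (LEAST b. c \<le> b \<or> (\<exists>a. prod_encode (a, b) = c))"
    by (rule Least_equality[symmetric]) (auto simp: c intro: le_trans[OF le_prod_encode_2])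
qed

definition rt :: "nat \<Rightarrow> real" where "rt c = of_rat (nat_to_rat_surj c)"

definition dyadic :: "nat \<Rightarrow> nat \<Rightarrow> nat" where
  "dyadic a n = prod_encode (int_encode (int a), int_encode (2 ^ n))"

lemma int_encode_of_nat: "int_encode (int a) = a + a"
  by (simp add: int_encode_def sum_encode_def)

lemma dyadic_eq: "dyadic a n = prod_encode (a + a, 2 ^ n + 2 ^ n)"
  using int_encode_of_nat[of a] int_encode_of_nat[of "2 ^ n"] by (simp add: dyadic_def)

lemma rt_dyadic: "rt (dyadic a n) = real a / 2 ^ n"
  by (simp add: rt_def dyadic_def nat_to_rat_surj_def of_rat_rat)

lemma int_decode_eq_if: "int_decode n = (if even n then int (n div 2) else - int (n div 2) - 1)"
  by (simp add: int_decode_def sum_decode_def)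

lemma rt_eq: "rt c = of_int (int_decode (fst (prod_decode c))) / of_int (int_decode (snd (prod_decode c)))"
  \<comment> \<open>A code with denominator 0 stands for 0, in agreement with division by 0.\<close>
  by (cases "int_decode (snd (prod_decode c)) = 0")
    (auto simp: rt_def nat_to_rat_surj_def of_rat_rat rat_number_collapse split: prod.split)

context
  fixes G :: tp3
begin

lemma kc_if:
  assumes "kd G p q P" "kc G p q a" "kc G p q b"
  shows "kc G p q (\<lambda>e. if P e then a e else b e)"
proof -
  \<comment> \<open>The truth value is the recursion argument: 0 leaves the initial value, and 1
    performs one step, which replaces it by \<open>b e\<close>.\<close>
  have "kc G p q (\<lambda>e. rec_nat (a e) (\<lambda>m u. b e) (if P e then 0 else 1))"
    by (intro kc_rec kc_weak assms(2,3) assms(1)[unfolded kd_def])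
  then show ?thesis by (rule kc_cong) simp
qed

lemma kc_pred:
  assumes "kc G p q a" shows "kc G p q (\<lambda>e. a e - 1)"
proof -
  have "kc G p q (\<lambda>e. rec_nat 0 (\<lambda>m u. m) (a e))"
    by (intro kc_rec kc_const kc_top assms)
  moreover have "rec_nat 0 (\<lambda>m u. m) y = y - 1" for y :: nat by (cases y) auto
  ultimately show ?thesis by simp
qed

lemma kc_add:
  assumes "kc G p q a" "kc G p q b" shows "kc G p q (\<lambda>e. a e + b e)"
proof -
  have "kc G p q (\<lambda>e. rec_nat (a e) (\<lambda>m u. Suc u) (b e))"
    by (intro kc_rec kc_Suc kc_weak[OF kc_top] assms)
  moreover have "rec_nat x (\<lambda>m u. Suc u) y = x + y" for x y by (induction y) auto
  ultimately show ?thesis by simp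
qed

lemma kc_diff:
  assumes "kc G p q a" "kc G p q b" shows "kc G p q (\<lambda>e. a e - b e)"
proof -
  have "kc G p q (\<lambda>e. rec_nat (a e) (\<lambda>m u. u - 1) (b e))"
    by (intro kc_rec kc_pred kc_weak[OF kc_top] assms)
  moreover have "rec_nat x (\<lambda>m u. u - 1) y = x - y" for x y :: nat by (induction y) auto
  ultimately show ?thesis by simp
qed

lemma kc_mult:
  assumes "kc G p q a" "kc G p q b" shows "kc G p q (\<lambda>e. a e * b e)"
proof -
  have "kc G p q (\<lambda>e. rec_nat 0 (\<lambda>m u. u + a e) (b e))"
    by (intro kc_rec kc_add kc_const kc_weak[OF kc_top] kc_weak[OF kc_weak] assms)
  moreover have "rec_nat 0 (\<lambda>m u. u + x) y = x * y" for x y :: nat by (induction y) auto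
  ultimately show ?thesis by simp
qed

lemma kc_pow2:
  assumes "kc G p q a" shows "kc G p q (\<lambda>e. 2 ^ a e)"
proof -
  have "kc G p q (\<lambda>e. rec_nat 1 (\<lambda>m u. u + u) (a e))"
    by (intro kc_rec kc_add kc_const kc_weak[OF kc_top] assms)
  moreover have "rec_nat 1 (\<lambda>m u. u + u) y = (2 :: nat) ^ y" for y by (induction y) auto
  ultimately show ?thesis by simp
qed

lemma kc_prod_encode:
  assumes "kc G p q a" "kc G p q b" shows "kc G p q (\<lambda>e. prod_encode (a e, b e))"
proof -
  have "kc G p q (\<lambda>e. rec_nat 0 (\<lambda>m u. u + Suc m) (a e + b e) + a e)"
    by (intro kc_add kc_rec kc_const kc_Suc kc_top kc_weak[OF kc_top] assms)
  moreover have "rec_nat 0 (\<lambda>m u. u + Suc m) y = triangle y" for y by (induction y) auto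
  ultimately show ?thesis by (simp add: prod_encode_def)
qed

lemma kd_eq0: assumes "kc G p q a" shows "kd G p q (\<lambda>e. a e = 0)"
proof -
  have "kc G p q (\<lambda>e. rec_nat 0 (\<lambda>m u. 1) (a e))"
    by (intro kc_rec kc_const assms)
  moreover have "rec_nat 0 (\<lambda>m u. 1 :: nat) y = (if y = 0 then 0 else 1)" for y :: nat by (cases y) auto
  ultimately show ?thesis by (simp add: kd_def)
qed

lemma kd_not: assumes "kd G p q P" shows "kd G p q (\<lambda>e. \<not> P e)"
proof -
  have "kc G p q (\<lambda>e. if P e then 1 else 0)"
    by (intro kc_if kc_const assms)
  then show ?thesis unfolding kd_def by (rule kc_cong) simp
qed

lemma kd_conj: assumes "kd G p q P" "kd G p q Q" shows "kd G p q (\<lambda>e. P e \<and> Q e)"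
proof -
  have "kc G p q (\<lambda>e. if P e then (if Q e then 0 else 1) else 1)"
    by (intro kc_if kc_const assms)
  then show ?thesis unfolding kd_def by (rule kc_cong) simp
qed

lemma kd_disj: assumes "kd G p q P" "kd G p q Q" shows "kd G p q (\<lambda>e. P e \<or> Q e)"
  using kd_not[OF kd_conj[OF kd_not kd_not]] assms by simp

lemma kd_all:
  assumes "kd G (Suc p) q (\<lambda>e. P (top_num e) (pop_num e))" shows "kd G p q (\<lambda>e. \<forall>m. P m e)"
  using kd_not[OF kd_ex[OF kd_not[OF assms]]] by simp

lemma kd_le: assumes "kc G p q a" "kc G p q b" shows "kd G p q (\<lambda>e. a e \<le> b e)"
  using kd_eq0[OF kc_diff[OF assms]] by simp

lemma kd_less: assumes "kc G p q a" "kc G p q b" shows "kd G p q (\<lambda>e. a e < b e)"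
  using kd_le[OF kc_Suc[OF assms(1)] assms(2)] by (simp add: Suc_le_eq)

lemma kd_eq: assumes "kc G p q a" "kc G p q b" shows "kd G p q (\<lambda>e. a e = b e)"
  using kd_conj[OF kd_le[OF assms] kd_le[OF assms(2,1)]] by (simp add: eq_iff)

lemma kc_Least:
  assumes "kd G (Suc p) q (\<lambda>e. P (top_num e) (pop_num e))" "kc G p q b"
  shows "kc G p q (\<lambda>e. LEAST j. b e \<le> j \<or> P j e)"
  unfolding bounded_least_rec
proof (intro kc_rec assms(2) kc_const kc_if kc_Suc kc_weak[OF kc_top])
  \<comment> \<open>The test concerns the candidate, which lies below the recursion counter.\<close>
  show "kd G (Suc (Suc p)) q (\<lambda>e. P (top_num (pop_num e)) (pop_num (pop_num e)))"
    using kc_weak[OF assms(1)[unfolded kd_def]] by (simp add: kd_def)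
qed

lemma kc_half: assumes "kc G p q a" shows "kc G p q (\<lambda>e. a e div 2)"
  unfolding half_Least by (intro kc_Least kd_le kc_add kc_Suc kc_top kc_weak assms)

lemma kc_fst_prod_decode: assumes "kc G p q a" shows "kc G p q (\<lambda>e. fst (prod_decode (a e)))"
  unfolding prod_decode_Least
  by (intro kc_Least assms kd_ex kd_eq kc_prod_encode kc_top kc_weak[OF kc_top] kc_weak[OF kc_weak])

lemma kc_snd_prod_decode: assumes "kc G p q a" shows "kc G p q (\<lambda>e. snd (prod_decode (a e)))"
  unfolding prod_decode_Least
  by (intro kc_Least assms kd_ex kd_eq kc_prod_encode kc_top kc_weak[OF kc_top] kc_weak[OF kc_weak])

lemma kd_even: assumes "kc G p q a" shows "kd G p q (\<lambda>e. even (a e))"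
proof -
  have "kd G p q (\<lambda>e. a e = a e div 2 + a e div 2)"
    by (intro kd_eq kc_add kc_half assms)
  moreover have "n = n div 2 + n div 2 \<longleftrightarrow> even n" for n :: nat by presburger
  ultimately show ?thesis by simp
qed

lemma kc_dyadic: assumes "kc G p q a" "kc G p q n" shows "kc G p q (\<lambda>e. dyadic (a e) (n e))"
  unfolding dyadic_eq by (intro kc_prod_encode kc_add kc_pow2 assms)

text \<open>Rationals are handled through numbers. A difference as numerator makes sums and products
  polynomial without a case distinction on signs, and a positive denominator leaves the sign to the
  numerator.\<close>

definition kq :: "nat \<Rightarrow> nat \<Rightarrow> (env \<Rightarrow> real) \<Rightarrow> bool" where
  "kq p q X \<longleftrightarrow> (\<exists>a b c. kc G p q a \<and> kc G p q b \<and> kc G p q c \<and>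
     (\<forall>e. c e > 0 \<and> X e = (real (a e) - real (b e)) / real (c e)))"

lemma kqI:
  "kc G p q a \<Longrightarrow> kc G p q b \<Longrightarrow> kc G p q c \<Longrightarrow> (\<And>e. c e > 0) \<Longrightarrow>
   (\<And>e. X e = (real (a e) - real (b e)) / real (c e)) \<Longrightarrow> kq p q X"
  unfolding kq_def by blast

lemma kqE:
  assumes "kq p q X"
  obtains a b c where "kc G p q a" "kc G p q b" "kc G p q c" "\<And>e. c e > 0"
    "\<And>e. X e = (real (a e) - real (b e)) / real (c e)"
  using assms unfolding kq_def by blast

lemma kq_of_nat: assumes "kc G p q a" shows "kq p q (\<lambda>e. real (a e))"
  by (rule kqI[OF assms kc_const[of _ _ _ 0] kc_const[of _ _ _ 1]]) auto

lemma kq_one: "kq p q (\<lambda>e. 1)" and kq_two: "kq p q (\<lambda>e. 2)"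
  using kq_of_nat[OF kc_const[of _ _ _ 1]] kq_of_nat[OF kc_const[of _ _ _ 2]] by auto

lemma kq_uminus: assumes "kq p q X" shows "kq p q (\<lambda>e. - X e)"
  using assms
proof (rule kqE)
  fix a b c assume *: "kc G p q a" "kc G p q b" "kc G p q c" "\<And>e. c e > 0"
    "\<And>e. X e = (real (a e) - real (b e)) / real (c e)"
  show ?thesis
    by (rule kqI[OF *(2,1,3,4)]) (use * in \<open>auto simp: field_simps\<close>)
qed

lemma kq_add: assumes "kq p q X" "kq p q Y" shows "kq p q (\<lambda>e. X e + Y e)"
  using assms(1)
proof (rule kqE)
  fix a b c assume 1: "kc G p q a" "kc G p q b" "kc G p q c" "\<And>e. c e > 0"
    "\<And>e. X e = (real (a e) - real (b e)) / real (c e)"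
  from assms(2) show ?thesis
  proof (rule kqE)
    fix a' b' c' assume 2: "kc G p q a'" "kc G p q b'" "kc G p q c'" "\<And>e. c' e > 0"
      "\<And>e. Y e = (real (a' e) - real (b' e)) / real (c' e)"
    show ?thesis
    proof (rule kqI)
      show "kc G p q (\<lambda>e. a e * c' e + a' e * c e)" "kc G p q (\<lambda>e. b e * c' e + b' e * c e)"
        "kc G p q (\<lambda>e. c e * c' e)"
        by (intro kc_add kc_mult 1 2)+
      show "c e * c' e > 0" for e using 1 2 by simp
      show "X e + Y e = (real (a e * c' e + a' e * c e) - real (b e * c' e + b' e * c e)) / real (c e * c' e)" for e
        using 1(4)[of e] 2(4)[of e] by (simp add: 1 2 field_simps)
    qed
  qed
qed

lemma kq_mult: assumes "kq p q X" "kq p q Y" shows "kq p q (\<lambda>e. X e * Y e)"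
  using assms(1)
proof (rule kqE)
  fix a b c assume 1: "kc G p q a" "kc G p q b" "kc G p q c" "\<And>e. c e > 0"
    "\<And>e. X e = (real (a e) - real (b e)) / real (c e)"
  from assms(2) show ?thesis
  proof (rule kqE)
    fix a' b' c' assume 2: "kc G p q a'" "kc G p q b'" "kc G p q c'" "\<And>e. c' e > 0"
      "\<And>e. Y e = (real (a' e) - real (b' e)) / real (c' e)"
    show ?thesis
    proof (rule kqI)
      show "kc G p q (\<lambda>e. a e * a' e + b e * b' e)" "kc G p q (\<lambda>e. a e * b' e + b e * a' e)"
        "kc G p q (\<lambda>e. c e * c' e)"
        by (intro kc_add kc_mult 1 2)+
      show "c e * c' e > 0" for e using 1 2 by simp
      show "X e * Y e = (real (a e * a' e + b e * b' e) - real (a e * b' e + b e * a' e)) / real (c e * c' e)" for e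
        using 1(4)[of e] 2(4)[of e] by (simp add: 1 2 field_simps)
    qed
  qed
qed

lemma kq_inverse: assumes "kq p q X" shows "kq p q (\<lambda>e. inverse (X e))"
  using assms
proof (rule kqE)
  fix a b c assume *: "kc G p q a" "kc G p q b" "kc G p q c" "\<And>e. c e > 0"
    "\<And>e. X e = (real (a e) - real (b e)) / real (c e)"
  show ?thesis
  proof (rule kqI)
    \<comment> \<open>The sum of the two truncated differences is |a - b|, and the sign goes into
      the choice of the numerator. For a = b the denominator 1 and the numerator 0 give the inverse
      of 0, which is 0.\<close>
    show "kc G p q (\<lambda>e. if b e < a e then c e else 0)" "kc G p q (\<lambda>e. if a e < b e then c e else 0)"
      "kc G p q (\<lambda>e. if a e = b e then 1 else (a e - b e) + (b e - a e))"
      by (intro kc_if kd_less kd_eq kc_add kc_diff kc_const *)+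
    show "0 < (if a e = b e then 1 else (a e - b e) + (b e - a e))" for e by auto
    show "inverse (X e) = (real (if b e < a e then c e else 0) - real (if a e < b e then c e else 0)) /
         real (if a e = b e then 1 else (a e - b e) + (b e - a e))" for e
      using *(4)[of e] by (cases "a e" "b e" rule: linorder_cases) (auto simp: *(5) of_nat_diff divide_simps algebra_simps)
  qed
qed

lemma kq_divide: assumes "kq p q X" "kq p q Y" shows "kq p q (\<lambda>e. X e / Y e)"
  using kq_mult[OF assms(1) kq_inverse[OF assms(2)]] by (simp add: divide_inverse)

lemma kq_diff: assumes "kq p q X" "kq p q Y" shows "kq p q (\<lambda>e. X e - Y e)"
  using kq_add[OF assms(1) kq_uminus[OF assms(2)]] by simp

lemma kq_if:
  assumes "kd G p q P" "kq p q X" "kq p q Y" shows "kq p q (\<lambda>e. if P e then X e else Y e)"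
proof -
  have "kq p q (\<lambda>e. real (if P e then 1 else 0) * X e + real (if P e then 0 else 1) * Y e)"
    by (intro kq_add kq_mult kq_of_nat kc_if kc_const assms)
  moreover have "(\<lambda>e. real (if P e then 1 else 0) * X e + real (if P e then 0 else 1) * Y e) =
      (\<lambda>e. if P e then X e else Y e)" by auto
  ultimately show ?thesis by simp
qed

lemma kd_less_kq: assumes "kq p q X" "kq p q Y" shows "kd G p q (\<lambda>e. X e < Y e)"
  using kq_diff[OF assms(2,1)]
proof (rule kqE)
  fix a b c assume *: "kc G p q a" "kc G p q b" "kc G p q c" "\<And>e. c e > 0"
    "\<And>e. Y e - X e = (real (a e) - real (b e)) / real (c e)"
  have "X e < Y e \<longleftrightarrow> b e < a e" for e
  proof -
    have "X e < Y e \<longleftrightarrow> 0 < Y e - X e" by simp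
    also have "\<dots> \<longleftrightarrow> b e < a e" using *(4)[of e] by (simp only: *(5)) (simp add: zero_less_divide_iff)
    finally show ?thesis .
  qed
  with kd_less[OF *(2,1)] show ?thesis by simp
qed

lemma kq_abs: assumes "kq p q X" shows "kq p q (\<lambda>e. \<bar>X e\<bar>)"
  using kq_if[OF kd_less_kq[OF assms kq_of_nat[OF kc_const[of _ _ _ 0]]] kq_uminus[OF assms] assms]
  by (simp add: abs_if)

lemma kq_pow2: assumes "kc G p q a" shows "kq p q (\<lambda>e. 2 ^ a e)"
  using kq_of_nat[OF kc_pow2[OF assms]] by simp

lemma kq_int_decode: assumes "kc G p q a" shows "kq p q (\<lambda>e. of_int (int_decode (a e)))"
proof -
  have "kq p q (\<lambda>e. if even (a e) then real (a e div 2) else - real (a e div 2) - 1)"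
    by (intro kq_if kd_even kq_of_nat kc_half kq_diff kq_uminus kq_one assms)
  moreover have "(\<lambda>e. of_int (int_decode (a e))) = (\<lambda>e. if even (a e) then real (a e div 2) else - real (a e div 2) - 1)"
    by (auto simp: int_decode_eq_if)
  ultimately show ?thesis by simp
qed

lemma kq_rt: assumes "kc G p q a" shows "kq p q (\<lambda>e. rt (a e))"
  unfolding rt_eq by (intro kq_divide kq_int_decode kc_fst_prod_decode kc_snd_prod_decode assms)

end

section \<open>The distance functional\<close>

lemma env_pop [simp]:
  "top_num (pop_fun e) = top_num e" "top_fun (pop_num e) = top_fun e"
  "pop_num (pop_fun e) = pop_fun (pop_num e)" "orc (pop_num e) = orc e" "orc (pop_fun e) = orc e"
  by (simp_all add: env_defs)

text \<open>All conditions are existential statements about rationals, so \<open>exists2\<close>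
  decides them; 1 / 2 ^ m bounds the error of entry m of a name.\<close>

definition off_unit :: "tp1 \<Rightarrow> bool" where
  "off_unit g \<longleftrightarrow> (\<exists>m. rt (g m) < - (1 / 2 ^ m) \<or> 1 + 1 / 2 ^ m < rt (g m)) \<or>
     (\<exists>m i. \<not> \<bar>rt (g m) - rt (g (m + i))\<bar> < 1 / 2 ^ m)"

text \<open>
  A realiser need not be extensional. The disjunct \<open>off_unit g\<close> makes \<open>radius\<close> independent of \<open>N\<close>
  also at the sequences \<open>g\<close> that name no point of \<open>[0,1]\<close>.
\<close>

definition clear :: "(tp1 \<Rightarrow> tp1) \<Rightarrow> tp1 \<Rightarrow> nat \<Rightarrow> nat \<Rightarrow> tp1 \<Rightarrow> nat \<Rightarrow> bool" where
  "clear \<Phi> f j n g k \<longleftrightarrow> off_unit g \<or>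
     (\<exists>m. 1 / 2 ^ k + 1 / 2 ^ m < rt (\<Phi> g m)) \<or>
     (\<exists>m. real j / 2 ^ n + 1 / 2 ^ k + 2 / 2 ^ m < \<bar>rt (g m) - rt (f m)\<bar>)"

text \<open>Entry \<open>i\<close> of a name of the function \<open>Y\<^sub>N\<close> at the point
  named by \<open>g\<close>. The bound \<open>i\<close> keeps the search finite, and
  \<open>N\<close> matters only where no k is clear.\<close>

definition radius :: "(tp1 \<Rightarrow> tp1) \<Rightarrow> tp1 \<Rightarrow> nat \<Rightarrow> nat \<Rightarrow> nat \<Rightarrow> tp1 \<Rightarrow> tp1" where
  "radius \<Phi> f j n N g i = dyadic 1 (LEAST k. i \<le> k \<or>
     (clear \<Phi> f j n g k \<or> (k = N \<and> \<not> (\<exists>k. clear \<Phi> f j n g k))))"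

text \<open>Compares returned sequences rather than reals. This suffices: in one case the arguments
  of \<open>M\<close> are identical, in the other the named reals cannot all agree.\<close>

definition ball_test :: "((tp1 \<Rightarrow> tp1) \<Rightarrow> tp1) \<Rightarrow> (tp1 \<Rightarrow> tp1) \<Rightarrow> tp1 \<Rightarrow> nat \<Rightarrow> nat \<Rightarrow> bool" where
  "ball_test M \<Phi> f j n \<longleftrightarrow> (\<forall>N i. M (radius \<Phi> f j n N) i = M (radius \<Phi> f j n 0) i)"

text \<open>The cap 2 ^ n stands for radius 1: no two points of [0,1] are further apart, and 1 is
  the prescribed value when the complement is empty.\<close>

definition distance :: "((tp1 \<Rightarrow> tp1) \<Rightarrow> tp1) \<Rightarrow> (tp1 \<Rightarrow> tp1) \<Rightarrow> tp1 \<Rightarrow> tp1" where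
  "distance M \<Phi> f n = dyadic (LEAST j. 2 ^ n \<le> j \<or> \<not> ball_test M \<Phi> f j n) n"

section \<open>Computability of the distance functional\<close>

lemma kc_orc:
  assumes "kf G p q x" "kc G p q t"
  shows "kc G p q (\<lambda>e. orc e (x e) (t e))"
proof -
  \<comment> \<open>The argument is the sequence t, x 0, x 1, ..., which codes the pair of the
    number t and the function x.\<close>
  have "kc G p q (\<lambda>e. pure2 (orc e) (\<lambda>m. if m = 0 then t e else x e (m - 1)))"
  proof (rule kc_orc2)
    show "kf G p q (\<lambda>e m. if m = 0 then t e else x e (m - 1))"
      unfolding kf_def
      by (intro kc_if kd_eq0 kc_top kc_weak[OF assms(2)])
        (rule kf_app[OF kf_weak[OF assms(1)] kc_pred[OF kc_top]])
  qed
  then show ?thesis by (simp add: pure2_def)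
qed

lemma kc_pure3:
  assumes "kc (pure3 M) p (Suc q) (\<lambda>e. \<Psi> (\<lambda>m. top_fun e (Suc m)) (top_fun e 0 - 1) (pop_fun e))"
    "kc (pure3 M) p (Suc q) (\<lambda>e. i (pop_fun e))"
  shows "kc (pure3 M) p q (\<lambda>e. M (\<lambda>g k. \<Psi> g k e) (i e))"
proof -
  \<comment> \<open>This type-2 functional codes the pair of \<open>i e\<close> and
    \<open>\<Psi>\<close>: it gives \<open>i e\<close> at the zero sequence, and a first entry Suc k
    selects entry k of the operator's output.\<close>
  have "kc (pure3 M) p q (\<lambda>e. pure3 M
      (\<lambda>h. if h 0 = 0 then i e else \<Psi> (\<lambda>m. h (Suc m)) (h 0 - 1) e))"
    by (rule kc_functional, intro kc_if kd_eq0 kf_app[OF kf_top] kc_const assms)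
  then show ?thesis by (simp add: pure3_def)
qed

lemma kd_off_unit:
  assumes "kf G p q g" shows "kd G p q (\<lambda>e. off_unit (g e))"
proof -
  have *: "kf G (Suc p) q (\<lambda>e. g (pop_num e))" "kf G (Suc (Suc p)) q (\<lambda>e. g (pop_num (pop_num e)))"
    by (intro kf_weak assms)+
  show ?thesis unfolding off_unit_def
    by (intro kd_disj kd_ex kd_not kd_less_kq kq_abs kq_divide kq_add kq_diff kq_uminus kq_pow2 kq_rt
      kq_one kc_add kf_app[OF *(1)] kf_app[OF *(2)] kc_top kc_weak[OF kc_top])
qed

lemma kd_clear:
  assumes "kf G p q f" "kf G p q g" "kc G p q j" "kc G p q n" "kc G p q k"
  shows "kd G p q (\<lambda>e. clear (orc e) (f e) (j e) (n e) (g e) (k e))"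
proof -
  have 1: "kf G (Suc p) q (\<lambda>e. f (pop_num e))" "kf G (Suc p) q (\<lambda>e. g (pop_num e))"
    by (intro kf_weak assms)+
  have 2: "kc G (Suc p) q (\<lambda>e. j (pop_num e))" "kc G (Suc p) q (\<lambda>e. n (pop_num e))"
    "kc G (Suc p) q (\<lambda>e. k (pop_num e))"
    by (intro kc_weak assms)+
  have 3: "kc G (Suc p) q (\<lambda>e. orc (pop_num e) (g (pop_num e)) (top_num e))"
    using kc_orc[OF 1(2) kc_top] by simp
  show ?thesis unfolding clear_def
    by (intro kd_disj kd_off_unit kd_ex kd_less_kq kq_abs kq_divide kq_add kq_diff kq_pow2 kq_rt
      kq_one kq_two kq_of_nat kf_app[OF 1(1)] kf_app[OF 1(2)] 2 3 kc_top assms)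
qed

lemma kc_radius:
  assumes "kf G p q f" "kf G p q g" "kc G p q j" "kc G p q n" "kc G p q N" "kc G p q i"
  shows "kc G p q (\<lambda>e. radius (orc e) (f e) (j e) (n e) (N e) (g e) (i e))"
proof -
  have 1: "kd G (Suc p) q (\<lambda>e. clear (orc (pop_num e)) (f (pop_num e)) (j (pop_num e)) (n (pop_num e))
      (g (pop_num e)) (top_num e))"
    unfolding env_pop by (intro kd_clear kf_weak kc_weak kc_top assms)
  then have "kd G (Suc p) q (\<lambda>e. \<exists>k. clear (orc (pop_num e)) (f (pop_num e)) (j (pop_num e)) (n (pop_num e))
      (g (pop_num e)) k)"
    using kc_weak[OF kd_ex[OF 1, unfolded kd_def]] by (simp add: kd_def)
  then show ?thesis unfolding radius_def
    by (intro kc_dyadic kc_Least kd_disj kd_conj kd_not kd_eq kc_const kc_top kc_weak assms 1)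
qed

lemma kd_ball_test:
  "kd (pure3 M) (Suc (Suc p)) (Suc q)
     (\<lambda>e. ball_test M (orc e) (top_fun e) (top_num e) (top_num (pop_num e)))"
proof -
  \<comment> \<open>Applying \<open>M\<close> binds a new function in front, so \<open>f\<close>
    becomes the second one. The equations say that the numerical parameters are unaffected by this
    push.\<close>
  have M: "kc (pure3 M) p' (Suc q) (\<lambda>e. M (radius (orc e) (top_fun e) (j e) (n e) (N e)) (i e))"
    if "\<And>q. kc (pure3 M) p' q j" "\<And>q. kc (pure3 M) p' q n" "\<And>q. kc (pure3 M) p' q N"
      "\<And>q. kc (pure3 M) p' q i"
      and eq: "\<And>e. j (pop_fun e) = j e" "\<And>e. n (pop_fun e) = n e" "\<And>e. N (pop_fun e) = N e"
        "\<And>e. i (pop_fun e) = i e"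
    for j n N i p'
  proof (rule kc_pure3)
    have "kf (pure3 M) p' (Suc (Suc q)) (\<lambda>e m. top_fun e (Suc m))"
      unfolding kf_def env_pop by (intro kf_app[OF kf_top] kc_Suc kc_top)
    then show "kc (pure3 M) p' (Suc (Suc q)) (\<lambda>e. radius (orc (pop_fun e)) (top_fun (pop_fun e))
        (j (pop_fun e)) (n (pop_fun e)) (N (pop_fun e)) (\<lambda>m. top_fun e (Suc m)) (top_fun e 0 - 1))"
      unfolding eq env_pop
      by (intro kc_radius kf_top_pop that kc_pred kf_app[OF kf_top] kc_const)
  qed (simp add: eq that)
  show ?thesis
    unfolding ball_test_def
    by (rule kd_all, rule kd_all, rule kd_eq; unfold env_pop, rule M)
      (auto intro!: kc_const kc_top kc_weak[OF kc_top] kc_weak[OF kc_weak[OF kc_top]]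
        kc_weak[OF kc_weak[OF kc_weak[OF kc_top]]])
qed

lemma distance_computable: "kleene_computable_in [exists2] [pure3 M] (distance M)"
proof -
  have "kc (pure3 M) (Suc 0) (Suc 0) (\<lambda>e. distance M (orc e) (top_fun e) (top_num e))"
    unfolding distance_def
    by (intro kc_dyadic kc_Least kd_not kc_top kc_pow2) (use kd_ball_test in simp)
  then obtain d where d: "\<And>\<Phi> as fs. length as = Suc 0 \<Longrightarrow> length fs = Suc 0 \<Longrightarrow>
     kleene d as fs [pure2 \<Phi>, exists2] [pure3 M]
       (distance M (orc (\<Phi>, as, fs)) (top_fun (\<Phi>, as, fs)) (top_num (\<Phi>, as, fs)))"
    by (rule kcE) blast
  have "kleene d [n] [f] (pure2 \<Phi> # [exists2]) [pure3 M] (distance M \<Phi> f n)" for \<Phi> f n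
    using d[of "[n]" "[f]" \<Phi>] by (simp add: env_defs)
  then show ?thesis unfolding kleene_computable_in_def by blast
qed

section \<open>Names of real numbers\<close>

lemma fast_cauchy_iff: "fast_cauchy f \<longleftrightarrow> (\<forall>n i. \<bar>rt (f n) - rt (f (n + i))\<bar> < 1 / 2 ^ n)"
proof -
  have "\<bar>nat_to_rat_surj a - nat_to_rat_surj b\<bar> < 1 / 2 ^ n \<longleftrightarrow> \<bar>rt a - rt b\<bar> < 1 / 2 ^ n" for a b n
  proof -
    have "\<bar>nat_to_rat_surj a - nat_to_rat_surj b\<bar> < 1 / 2 ^ n \<longleftrightarrow>
        (of_rat \<bar>nat_to_rat_surj a - nat_to_rat_surj b\<bar> :: real) < of_rat (1 / 2 ^ n)"
      by (simp only: of_rat_less)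
    also have "\<dots> \<longleftrightarrow> \<bar>rt a - rt b\<bar> < 1 / 2 ^ n"
      by (simp add: rt_def abs_if of_rat_diff of_rat_minus of_rat_less of_rat_divide of_rat_power)
    finally show ?thesis .
  qed
  then show ?thesis by (simp add: fast_cauchy_def)
qed

lemma real_name_iff: "real_name f x \<longleftrightarrow> fast_cauchy f \<and> (\<lambda>n. rt (f n)) \<longlonglongrightarrow> x"
  by (simp add: real_name_def rt_def)

lemma real_name_unique: "real_name f x \<Longrightarrow> real_name f y \<Longrightarrow> x = y"
  unfolding real_name_iff using LIMSEQ_unique by blast

lemma real_name_dist: assumes "real_name f x" shows "\<bar>rt (f n) - x\<bar> \<le> 1 / 2 ^ n"
proof -
  have "(\<lambda>i. \<bar>rt (f n) - rt (f (n + i))\<bar>) \<longlonglongrightarrow> \<bar>rt (f n) - x\<bar>"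
    using assms LIMSEQ_ignore_initial_segment[of "\<lambda>n. rt (f n)" x n]
    by (intro tendsto_intros) (simp add: real_name_iff add.commute)
  then show ?thesis
    by (rule LIMSEQ_le_const2) (use assms in \<open>auto simp: real_name_iff fast_cauchy_iff intro: less_imp_le\<close>)
qed

lemma ex_pow2_less: "0 < c \<Longrightarrow> \<exists>m. 1 / 2 ^ m < c" for c :: real
  using one_less_inverse real_arch_pow_inv[of c "1/2"] by (simp add: power_one_over)

lemma fast_cauchy_imp_real_name:
  assumes "fast_cauchy f" obtains x where "real_name f x"
proof -
  have "Cauchy (\<lambda>n. rt (f n))"
  proof (rule CauchyI')
    fix e :: real assume "0 < e"
    then obtain m where m: "1 / 2 ^ m < e / 2" using ex_pow2_less[of "e / 2"] by auto
    have *: "\<bar>rt (f m) - rt (f n)\<bar> < e / 2" if "n \<ge> m" for n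
      using assms[unfolded fast_cauchy_iff, rule_format, of m "n - m"] m that by simp
    have "dist (rt (f a)) (rt (f b)) < e" if "a \<ge> m" "b > a" for a b
      using *[OF that(1)] *[OF order.trans[OF that(1) less_imp_le[OF that(2)]]]
      unfolding dist_real_def by linarith
    then show "\<exists>M. \<forall>m\<ge>M. \<forall>n>m. dist (rt (f m)) (rt (f n)) < e" by blast
  qed
  then obtain x where "(\<lambda>n. rt (f n)) \<longlonglongrightarrow> x"
    by (metis Cauchy_convergent convergent_def)
  with that assms show ?thesis by (auto simp: real_name_iff)
qed

lemma real_name_approx:
  assumes "\<And>n. \<bar>rt (f n) - x\<bar> \<le> 1 / 2 ^ n" "\<And>n i. \<bar>rt (f n) - rt (f (n + i))\<bar> < 1 / 2 ^ n"
  shows "real_name f x"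
proof -
  have "(\<lambda>n. 1 / 2 ^ n :: real) \<longlonglongrightarrow> 0"
    using LIMSEQ_realpow_zero[of "1/2::real"] by (simp add: power_one_over)
  then have "(\<lambda>n. rt (f n) - x) \<longlonglongrightarrow> 0"
    by (rule Lim_null_comparison[rotated]) (use assms(1) in auto)
  then show ?thesis using assms(2) by (simp add: real_name_iff fast_cauchy_iff LIM_zero_iff)
qed

text \<open>The margin 1 / 2 ^ m absorbs the error of entry m; conversely, any m with margin and
  error together below y - c is a witness.\<close>

lemma ex_less_name_iff:
  assumes "real_name h y" shows "(\<exists>m. c + 1 / 2 ^ m < rt (h m)) \<longleftrightarrow> c < y"
proof
  assume "\<exists>m. c + 1 / 2 ^ m < rt (h m)"
  then obtain m where "c + 1 / 2 ^ m < rt (h m)" by blast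
  with real_name_dist[OF assms, of m] show "c < y" by linarith
next
  assume "c < y"
  then obtain m where "1 / 2 ^ m < (y - c) / 2" using ex_pow2_less[of "(y - c) / 2"] by auto
  then have "2 * (1 / 2 ^ m) < y - c" by simp
  with real_name_dist[OF assms, of m] have "c + 1 / 2 ^ m < rt (h m)" by linarith
  then show "\<exists>m. c + 1 / 2 ^ m < rt (h m)" by blast
qed

lemma ex_less_dist_iff:
  assumes "real_name g y" "real_name f x"
  shows "(\<exists>m. c + 2 / 2 ^ m < \<bar>rt (g m) - rt (f m)\<bar>) \<longleftrightarrow> c < \<bar>y - x\<bar>"
proof
  assume "\<exists>m. c + 2 / 2 ^ m < \<bar>rt (g m) - rt (f m)\<bar>"
  then obtain m where "c + 2 * (1 / 2 ^ m) < \<bar>rt (g m) - rt (f m)\<bar>" by auto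
  with real_name_dist[OF assms(1), of m] real_name_dist[OF assms(2), of m]
  show "c < \<bar>y - x\<bar>" by linarith
next
  assume "c < \<bar>y - x\<bar>"
  \<comment> \<open>Of the four quarters of the gap, two pay for the margin and two for the errors
    of the two names.\<close>
  then obtain m where "1 / 2 ^ m < (\<bar>y - x\<bar> - c) / 4" using ex_pow2_less[of "(\<bar>y - x\<bar> - c) / 4"] by auto
  then have "4 * (1 / 2 ^ m) < \<bar>y - x\<bar> - c" by simp
  with real_name_dist[OF assms(1), of m] real_name_dist[OF assms(2), of m]
  have "c + 2 * (1 / 2 ^ m) < \<bar>rt (g m) - rt (f m)\<bar>" by linarith
  then show "\<exists>m. c + 2 / 2 ^ m < \<bar>rt (g m) - rt (f m)\<bar>" by auto
qed

lemma off_unit_iff: "off_unit g \<longleftrightarrow> \<not> (\<exists>y\<in>{0..1}. real_name g y)"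
proof
  assume off: "off_unit g"
  show "\<not> (\<exists>y\<in>{0..1}. real_name g y)"
  proof
    assume "\<exists>y\<in>{0..1}. real_name g y"
    then obtain y where y: "0 \<le> y" "y \<le> 1" "real_name g y" by auto
    then obtain m where "rt (g m) < - (1 / 2 ^ m) \<or> 1 + 1 / 2 ^ m < rt (g m)"
      using off by (auto simp: off_unit_def real_name_iff fast_cauchy_iff)
    with real_name_dist[OF y(3), of m] y(1,2) show False by linarith
  qed
next
  assume no: "\<not> (\<exists>y\<in>{0..1}. real_name g y)"
  show "off_unit g"
  proof (cases "fast_cauchy g")
    case True
    then obtain y where y: "real_name g y" by (rule fast_cauchy_imp_real_name)
    with no have "y < 0 \<or> 1 < y" by force
    then show ?thesis
    proof
      assume "1 < y"
      then obtain m where "1 + 1 / 2 ^ m < rt (g m)" using ex_less_name_iff[OF y] by blast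
      then show ?thesis unfolding off_unit_def by blast
    next
      assume "y < 0"
      then obtain m where "1 / 2 ^ m < - y / 2" using ex_pow2_less[of "- y / 2"] by auto
      then have "2 * (1 / 2 ^ m) < - y" by simp
      with real_name_dist[OF y, of m] have "rt (g m) < - (1 / 2 ^ m)" by linarith
      then show ?thesis unfolding off_unit_def by blast
    qed
  next
    case False
    then show ?thesis unfolding off_unit_def fast_cauchy_iff by blast
  qed
qed

text \<open>On names the test depends only on the named point, which makes \<open>radius\<close> a
  name of a real function.\<close>

lemma clear_iff:
  assumes "real_name g y" "y \<in> {0..1}" "real_name f x" "real_name (\<Phi> g) z"
  shows "clear \<Phi> f j n g k \<longleftrightarrow> 1 / 2 ^ k < z \<or> real j / 2 ^ n + 1 / 2 ^ k < \<bar>y - x\<bar>"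
  using assms unfolding clear_def off_unit_iff ex_less_name_iff[OF assms(4)] ex_less_dist_iff[OF assms(1,3)]
  by blast

text \<open>A sequence that stops at the first \<open>k\<close> satisfying a condition names \<open>1 / 2 ^ k\<close>: its
  entries are found by bounded search even if there is no such \<open>k\<close>.\<close>

lemma real_name_Least:
  assumes "P k"
  shows "real_name (\<lambda>i. dyadic 1 (LEAST k. i \<le> k \<or> P k)) (1 / 2 ^ (LEAST k. P k))"
proof -
  define l where "l = (LEAST k. P k)"
  have "(LEAST k. i \<le> k \<or> P k) = min i l" for i
  proof (rule Least_equality)
    show "i \<le> min i l \<or> P (min i l)"
      using LeastI[of P, OF assms] by (auto simp: l_def min_def)
    show "min i l \<le> y" if "i \<le> y \<or> P y" for y
      using that Least_le[of P y] by (auto simp: l_def)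
  qed
  then have eq: "rt (dyadic 1 (LEAST k. i \<le> k \<or> P k)) = 1 / 2 ^ min i l" for i
    by (simp add: rt_dyadic)
  have *: "\<bar>1 / 2 ^ min n l - 1 / 2 ^ m\<bar> < (1 / 2 ^ n :: real)" if "min n l \<le> m" "m \<le> l" for m n
  proof (cases "n \<le> l")
    case True
    have "(1 :: real) / 2 ^ m \<le> 1 / 2 ^ n" using that True by (intro divide_left_mono power_increasing) auto
    then show ?thesis using True by simp
  next
    case False
    then show ?thesis using that by (simp add: min_def)
  qed
  show ?thesis
    unfolding l_def[symmetric]
  proof (rule real_name_approx)
    fix n i
    show "\<bar>rt (dyadic 1 (LEAST k. n \<le> k \<or> P k)) - 1 / 2 ^ l\<bar> \<le> 1 / 2 ^ n"
      unfolding eq using *[of n l] by simp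
    show "\<bar>rt (dyadic 1 (LEAST k. n \<le> k \<or> P k)) - rt (dyadic 1 (LEAST k. n + i \<le> k \<or> P k))\<bar> < 1 / 2 ^ n"
      unfolding eq using *[of n "min (n + i) l"] by simp
  qed
qed

text \<open>Rounding up puts the errors of entry n and of all later entries into [0, 1 / 2 ^ n), so
  any two of these entries differ by strictly less than 1 / 2 ^ n.\<close>

lemma real_name_upper_dyadic:
  assumes "0 \<le> d"
  shows "real_name (\<lambda>n. dyadic (LEAST j. d \<le> real j / 2 ^ n) n) d"
proof -
  have *: "d \<le> real (LEAST j. d \<le> real j / 2 ^ n) / 2 ^ n \<and>
      real (LEAST j. d \<le> real j / 2 ^ n) / 2 ^ n < d + 1 / 2 ^ n" for n
  proof -
    define l where "l = (LEAST j. d \<le> real j / 2 ^ n)"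
    have "d \<le> real (nat \<lceil>d * 2 ^ n\<rceil>) / 2 ^ n"
      using assms by (simp add: le_divide_eq)
    then have 1: "d \<le> real l / 2 ^ n" unfolding l_def by (rule LeastI)
    have "real l / 2 ^ n < d + 1 / 2 ^ n"
    proof (cases l)
      case 0
      then show ?thesis using assms by (simp add: add_nonneg_pos)
    next
      case (Suc m)
      then have "\<not> d \<le> real m / 2 ^ n"
        using not_less_Least[of m "\<lambda>j. d \<le> real j / 2 ^ n"] by (simp add: l_def)
      then show ?thesis by (simp add: Suc add_divide_distrib)
    qed
    with 1 show ?thesis by (simp add: l_def)
  qed
  show ?thesis
  proof (rule real_name_approx; unfold rt_dyadic)
    fix n i :: nat
    show "\<bar>real (LEAST j. d \<le> real j / 2 ^ n) / 2 ^ n - d\<bar> \<le> 1 / 2 ^ n"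
      using *[of n] by (simp add: abs_le_iff)
    have "(1 :: real) / 2 ^ (n + i) \<le> 1 / 2 ^ n" by (intro divide_left_mono power_increasing) auto
    with *[of n] *[of "n + i"]
    show "\<bar>real (LEAST j. d \<le> real j / 2 ^ n) / 2 ^ n - real (LEAST j. d \<le> real j / 2 ^ (n + i)) / 2 ^ (n + i)\<bar>
        < 1 / 2 ^ n"
      by linarith
  qed
qed

section \<open>Correctness of the distance functional\<close>

lemma ball_test_iff:
  assumes M: "pincherle_realiser M" and \<Phi>: "fun_name \<Phi> Y" and Y: "R2 Y U"
    and x: "x \<in> {0..1}" "real_name f x"
  shows "ball_test M \<Phi> f j n \<longleftrightarrow> (\<forall>y\<in>{0..1} - U. real j / 2 ^ n < \<bar>y - x\<bar>)"
proof
  assume far: "\<forall>y\<in>{0..1} - U. real j / 2 ^ n < \<bar>y - x\<bar>"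
  \<comment> \<open>Needed for all sequences, not just for names: equal functionals must be
    obtained, since \<open>M\<close> may distinguish two names of one function.\<close>
  have "\<exists>k. clear \<Phi> f j n g k" for g
  proof (cases "off_unit g")
    case True
    then show ?thesis by (simp add: clear_def)
  next
    case False
    then obtain y where y: "y \<in> {0..1}" "real_name g y" by (auto simp: off_unit_iff)
    have c: "clear \<Phi> f j n g k \<longleftrightarrow> 1 / 2 ^ k < Y y \<or> real j / 2 ^ n + 1 / 2 ^ k < \<bar>y - x\<bar>" for k
      by (rule clear_iff[OF y(2,1) x(2)]) (use \<Phi> y in \<open>auto simp: fun_name_def\<close>)
    show ?thesis
    proof (cases "y \<in> U")
      case True
      then have "0 < Y y" using Y by (auto simp: R2_def)
      then show ?thesis using ex_pow2_less[of "Y y"] c by blast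
    next
      case False
      then have "0 < \<bar>y - x\<bar> - real j / 2 ^ n" using far y by auto
      then obtain k where "1 / 2 ^ k < \<bar>y - x\<bar> - real j / 2 ^ n" using ex_pow2_less by blast
      then have "clear \<Phi> f j n g k" unfolding c by linarith
      then show ?thesis ..
    qed
  qed
  then have "radius \<Phi> f j n N = radius \<Phi> f j n 0" for N by (simp add: radius_def fun_eq_iff)
  then show "ball_test M \<Phi> f j n" unfolding ball_test_def by metis
next
  assume test: "ball_test M \<Phi> f j n"
  show "\<forall>y\<in>{0..1} - U. real j / 2 ^ n < \<bar>y - x\<bar>"
  proof (rule ccontr)
    assume "\<not> (\<forall>y\<in>{0..1} - U. real j / 2 ^ n < \<bar>y - x\<bar>)"
    then obtain z where z: "z \<in> {0..1}" "z \<notin> U" "\<bar>z - x\<bar> \<le> real j / 2 ^ n" by force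
    define c where "c y k \<longleftrightarrow> 1 / 2 ^ k < Y y \<or> real j / 2 ^ n + 1 / 2 ^ k < \<bar>y - x\<bar>" for y k
    define l where "l N y = (LEAST k. c y k \<or> (k = N \<and> \<not> (\<exists>k. c y k)))" for N y
    have l: "c y (l N y) \<or> l N y = N" for N y
    proof -
      have "\<exists>k. c y k \<or> (k = N \<and> \<not> (\<exists>k. c y k))" by blast
      from LeastI_ex[OF this] show ?thesis unfolding l_def by blast
    qed
    have name: "fun_name (radius \<Phi> f j n N) (\<lambda>y. 1 / 2 ^ l N y)" for N
      unfolding fun_name_def
    proof (intro ballI allI impI)
      fix y :: real and g assume y: "y \<in> {0..1}" "real_name g y"
      have c: "clear \<Phi> f j n g k \<longleftrightarrow> c y k" for k
        unfolding c_def by (rule clear_iff[OF y(2,1) x(2)]) (use \<Phi> y in \<open>auto simp: fun_name_def\<close>)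
      obtain k where k: "c y k \<or> (k = N \<and> \<not> (\<exists>k. c y k))" by blast
      show "real_name (radius \<Phi> f j n N g) (1 / 2 ^ l N y)"
        using real_name_Least[of "\<lambda>k. c y k \<or> (k = N \<and> \<not> (\<exists>k. c y k))", OF k]
        by (simp add: radius_def[abs_def] c l_def)
    qed
    have "\<exists>m>0. real_name (M (radius \<Phi> f j n N)) m \<and> m \<le> 2 / 2 ^ N" for N
    proof -
      obtain m where m: "m > 0" "real_name (M (radius \<Phi> f j n N)) m"
        "\<And>Z. bounded_away_by (\<lambda>y. 1 / 2 ^ l N y) Z \<Longrightarrow> \<forall>x\<in>{0..1}. m \<le> Z x"
        using M name[of N] unfolding pincherle_realiser_def by force
      \<comment> \<open>The value 2 exceeds every radius. At \<open>z\<close> the value only has to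
        exceed the radii of balls that contain \<open>z\<close>, and these are all 1 / 2 ^
        N.\<close>
      have "bounded_away_by (\<lambda>y. 1 / 2 ^ l N y) (\<lambda>y. if y = z then 2 / 2 ^ N else 2)"
        unfolding bounded_away_by_def
      proof (intro ballI impI)
        fix y w :: real assume y: "y \<in> {0..1}" "\<bar>y - w\<bar> < 1 / 2 ^ l N y"
        show "1 / 2 ^ l N y < (if w = z then 2 / 2 ^ N else 2 :: real)"
        proof (cases "w = z")
          case True
          have "\<not> c y (l N y)"
          proof
            assume "c y (l N y)"
            then consider "1 / 2 ^ l N y < Y y" | "real j / 2 ^ n + 1 / 2 ^ l N y < \<bar>y - x\<bar>"
              unfolding c_def by blast
            then show False
            \<comment> \<open>In the first case \<open>z\<close> lies in the ball of radius Y y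
              around y, which R2 includes in U; in the second the triangle inequality puts
              \<open>z\<close> outside the tested ball.\<close>
            proof cases
              case 1
              then have "\<bar>y - z\<bar> < Y y" using y True by linarith
              then have "0 < Y y" "z \<in> {y - Y y<..<y + Y y}" by auto
              then show False using Y y(1) z(1,2) unfolding R2_def by blast
            next
              case 2
              then show False using y True z(3) by linarith
            qed
          qed
          then have "l N y = N" using l by blast
          then show ?thesis using True by (simp add: divide_strict_right_mono)
        next
          case False
          have "(1 :: real) / 2 ^ l N y < 2" by (rule order.strict_trans1[of _ 1]) simp_all
          with False show ?thesis by simp
        qed
      qed
      from m(3)[OF this] z(1) have "m \<le> 2 / 2 ^ N" by force
      with m(1,2) show ?thesis by blast
    qed
    then obtain m where m: "\<And>N. m N > 0" "\<And>N. real_name (M (radius \<Phi> f j n N)) (m N)"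
      "\<And>N. m N \<le> 2 / 2 ^ N" by metis
    \<comment> \<open>A passed test makes every \<open>m N\<close> equal to the positive real
      \<open>m 0\<close>, so it is enough to make 2 / 2 ^ N smaller than that.\<close>
    obtain N where N: "1 / 2 ^ N < m 0 / 2"
      using ex_pow2_less[of "m 0 / 2"] m(1)[of 0] by auto
    have "M (radius \<Phi> f j n N) = M (radius \<Phi> f j n 0)"
      using test unfolding ball_test_def by blast
    with m(2)[of N] have "real_name (M (radius \<Phi> f j n 0)) (m N)" by (simp only:)
    then have "m N = m 0" using m(2)[of 0] by (rule real_name_unique)
    with m(3)[of N] have "m 0 \<le> 2 / 2 ^ N" by (simp only:)
    with N show False by simp
  qed
qed

lemma distance_represents:
  assumes M: "pincherle_realiser M" and U: "openin (top_of_set {0..1}) U" and "represents_R2 \<Phi> U"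
  shows "represents_R3 (distance M \<Phi>) U"
proof -
  obtain Y where \<Phi>: "fun_name \<Phi> Y" and Y: "R2 Y U" using assms(3) by (auto simp: represents_R2_def)
  define d where "d x = (if {0..1} - U \<noteq> {} then infdist x ({0..1} - U) else 1)" for x :: real
  \<comment> \<open>Closedness makes the distance attained, so a closed ball of radius r around x
    meets a nonempty complement exactly when d x is at most r.\<close>
  have cl: "closed ({0..1} - U)"
    using U by (metis closed_atLeastAtMost closedin_closed_trans closedin_diff closedin_topspace topspace_euclidean_subtopology)
  \<comment> \<open>With this equivalence the output of \<open>distance\<close> is literally the
    upward rounding of d x.\<close>
  have test: "2 ^ n \<le> j \<or> \<not> ball_test M \<Phi> f j n \<longleftrightarrow> d x \<le> real j / 2 ^ n"
    if x: "x \<in> {0..1}" "real_name f x" for x f j n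
  proof -
    have n: "2 ^ n \<le> j \<longleftrightarrow> 1 \<le> real j / 2 ^ n"
      using of_nat_le_iff[of "2 ^ n" j, where 'a = real] by (simp add: le_divide_eq)
    show ?thesis
    proof (cases "{0..1} - U = {}")
      case True
      \<comment> \<open>Every ball passes the test, so only the cap stops the search, at radius
        1.\<close>
      then show ?thesis unfolding ball_test_iff[OF M \<Phi> Y x] n d_def True by simp
    next
      case False
      then obtain z where z: "z \<in> {0..1} - U" "infdist x ({0..1} - U) = dist x z"
        using infdist_attains_inf[OF cl] by blast
      \<comment> \<open>Hence the cap is compatible with d x: reaching radius 1 already implies that
        the radius is at least d x.\<close>
      have "dist x z \<le> 1" using x z(1) by (auto simp: dist_real_def)
      moreover have "(\<forall>y\<in>{0..1} - U. real j / 2 ^ n < \<bar>y - x\<bar>) \<longleftrightarrow> real j / 2 ^ n < dist x z"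
      proof
        assume "\<forall>y\<in>{0..1} - U. real j / 2 ^ n < \<bar>y - x\<bar>"
        from bspec[OF this z(1)] show "real j / 2 ^ n < dist x z"
          by (simp add: dist_real_def abs_minus_commute)
      next
        assume less: "real j / 2 ^ n < dist x z"
        show "\<forall>y\<in>{0..1} - U. real j / 2 ^ n < \<bar>y - x\<bar>"
        proof
          fix y assume "y \<in> {0..1} - U"
          from infdist_le[OF this, of x] less show "real j / 2 ^ n < \<bar>y - x\<bar>"
            unfolding z(2) dist_real_def by linarith
        qed
      qed
      moreover have "d x = dist x z" using False z(2) by (simp add: d_def)
      ultimately show ?thesis unfolding ball_test_iff[OF M \<Phi> Y x] n by linarith
    qed
  qed
  have "fun_name (distance M \<Phi>) d"
    unfolding fun_name_def
  proof (intro ballI allI impI)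
    fix x :: real and f assume x: "x \<in> {0..1}" "real_name f x"
    have "0 \<le> d x" by (simp add: d_def infdist_nonneg)
    from real_name_upper_dyadic[OF this] show "real_name (distance M \<Phi> f) (d x)"
      by (simp add: distance_def[abs_def] test[OF x])
  qed
  moreover have "R3 d U"
    unfolding R3_def
    by (cases "{0..1} - U = {}") (auto simp: d_def[abs_def] intro!: continuous_intros)
  ultimately show ?thesis unfolding represents_R3_def by blast
qed

theorem theorem7p5:
  fixes Mu :: "(tp1 \<Rightarrow> tp1) \<Rightarrow> tp1"
  assumes "pincherle_realiser Mu"
  shows "\<exists>\<Delta> :: (tp1 \<Rightarrow> tp1) \<Rightarrow> (tp1 \<Rightarrow> tp1).
           kleene_computable_in [exists2] [pure3 Mu] \<Delta> \<and>
           (\<forall>\<Phi> U. openin (top_of_set {0..1}) U \<and> represents_R2 \<Phi> U \<longrightarrow>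
                   represents_R3 (\<Delta> \<Phi>) U)"
  using distance_computable distance_represents[OF assms] by blast

end
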